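(* Let $X$ be a field and let $M_1, M_2, N_1, N_2 : X \to [0, \infty)$ be functions. Suppose that a function $f : X^2 \to \mathbb{C}$ satisfies the inequality $$\left| f(x_1, y_1) f(x_2, y_2) - f(x_1 x_2 + y_1 y_2,\; x_1 y_2 - y_1 x_2) \right| \leq \min\{ M_1(x_1), M_2(x_2), N_1(y_1), N_2(y_2) \}$$ for all $x_1, x_2, y_1, y_2 \in X$. Then the function $x \mapsto f(x,0)$ from $X$ to $\mathbb{C}$ is either bounded or multiplicative, and furthermore $$\left| f(x,y)^2 - f(x^2 + y^2, 0) \right| \leq \min\{ M_1(x), M_2(x), N_1(y), N_2(y) \}$$ for all $x, y \in X$.
   Context: A function $m : X \to \mathbb{C}$ on a field $X$ is called multiplicative if $m(xy) = m(x)m(y)$ for all $x, y \in X$. It is bounded if $\sup_{x \in X} |m(x)| < \infty$. *)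

theory Defs
  imports "HOL-Analysis.Analysis"
begin

definition multiplicative :: "('a::field \<Rightarrow> complex) \<Rightarrow> bool" where
  "multiplicative m \<longleftrightarrow> (\<forall>x y. m (x * y) = m x * m y)"

end

theory Submission imports Defs begin

text \<open>
  On the slice \<open>y1 = y2 = 0\<close> the second argument \<open>x1 * y2 - y1 * x2\<close> vanishes, so
  \<open>g x = f (x, 0)\<close> is multiplicative up to an error at most \<open>N1 0\<close>, a constant. Baker's
  superstability argument then applies: associativity forces the defect \<open>g x * g y - g (x * y)\<close>,
  even after multiplication by any value \<open>g z\<close>, to stay below a bound independent of \<open>z\<close>. Hence a
  single nonzero defect makes \<open>g\<close> bounded.

  On the diagonal \<open>(x1, y1) = (x2, y2)\<close> the second argument vanishes again, by commutativity of
  the field, and the hypothesis is itself the second claim.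
\<close>

text \<open>
  Superstability of the multiplicative equation. Expanding \<open>g (x * y * z)\<close> in the two possible
  groupings costs one error \<open>d\<close> each, and splitting \<open>g (y * z)\<close> under the factor \<open>g x\<close> costs
  \<open>cmod (g x) * d\<close>; none of these depends on \<open>z\<close>, which is what bounds \<open>g z\<close>.
\<close>

lemma almost_multiplicative_bounded_or_multiplicative:
  fixes g :: "'a::field \<Rightarrow> complex"
  assumes defect: "\<And>x y. cmod (g x * g y - g (x * y)) \<le> d"
  shows "bounded (range g) \<or> multiplicative g"
proof (cases "multiplicative g")
  case False
  then obtain x y where "g (x * y) \<noteq> g x * g y"
    by (auto simp: multiplicative_def)
  then have pos: "0 < cmod (g x * g y - g (x * y))"
    by simp
  have "cmod (g z) \<le> (2 * d + cmod (g x) * d) / cmod (g x * g y - g (x * y))" for z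
  proof -
    let ?left = "g (x * y) * g z - g (x * y * z)"
      and ?right = "g x * g (y * z) - g (x * (y * z))"
      and ?inner = "g x * (g y * g z - g (y * z))"
    have "(g x * g y - g (x * y)) * g z = ?inner + ?right - ?left"
      by (simp add: algebra_simps)
    then have "cmod (g x * g y - g (x * y)) * cmod (g z) = cmod (?inner + ?right - ?left)"
      by (metis norm_mult)
    also have "\<dots> \<le> cmod ?inner + cmod ?right + cmod ?left"
      using norm_triangle_ineq4[of "?inner + ?right" ?left] norm_triangle_ineq[of ?inner ?right]
      by linarith
    also have "\<dots> \<le> cmod (g x) * d + d + d"
      by (intro add_mono defect) (simp add: norm_mult mult_left_mono defect)
    finally show ?thesis
      using pos by (simp add: field_simps)
  qed
  then have "bounded (range g)"
    by (auto intro!: boundedI)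
  then show ?thesis ..
qed simp

theorem theorem2:
  fixes M1 M2 N1 N2 :: "'a::field \<Rightarrow> real"
    and f :: "'a \<times> 'a \<Rightarrow> complex"
  assumes "\<And>x. 0 \<le> M1 x" and "\<And>x. 0 \<le> M2 x"
    and "\<And>y. 0 \<le> N1 y" and "\<And>y. 0 \<le> N2 y"
    and "\<And>x1 x2 y1 y2.
      cmod (f (x1, y1) * f (x2, y2) - f (x1 * x2 + y1 * y2, x1 * y2 - y1 * x2))
        \<le> Min {M1 x1, M2 x2, N1 y1, N2 y2}"
  shows "(bounded (range (\<lambda>x. f (x, 0))) \<or> multiplicative (\<lambda>x. f (x, 0))) \<and>
    (\<forall>x y. cmod ((f (x, y))\<^sup>2 - f (x\<^sup>2 + y\<^sup>2, 0)) \<le> Min {M1 x, M2 x, N1 y, N2 y})"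
proof (intro conjI allI)
  have "cmod (f (x, 0) * f (y, 0) - f (x * y, 0)) \<le> N1 0" for x y
    using assms(5)[of x 0 y 0] by simp
  then show "bounded (range (\<lambda>x. f (x, 0))) \<or> multiplicative (\<lambda>x. f (x, 0))"
    by (rule almost_multiplicative_bounded_or_multiplicative)
next
  fix x y
  show "cmod ((f (x, y))\<^sup>2 - f (x\<^sup>2 + y\<^sup>2, 0)) \<le> Min {M1 x, M2 x, N1 y, N2 y}"
    using assms(5)[of x y x y] by (simp add: power2_eq_square mult.commute)
qed

end
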